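(* Let $L\ge4$ be an even integer, let $\Omega$ be the collection of independent sets of the $L\times L$ toric grid, and let $\mathcal E,\mathcal O\in\Omega$ be the sets of even and odd vertices. Then the communication height $\Gamma:=\phi(\mathcal E,\mathcal O)$ between $\mathcal E$ and $\mathcal O$ satisfies $$\Gamma=L+1 .$$
   Context: Toric grid: $G=(V,E)$ with $V=\{1,\dots,L\}^2$, $L$ even, two vertices being adjacent iff they differ by $1\pmod L$ in exactly one coordinate. A vertex is even (odd) if the sum of its coordinates is even (odd). For $I\in\Omega$ the efficiency gap is $\Delta(I):=L^2/2-|I|$. A path $\omega: I\to I'$ is a finite sequence $(I_1,\dots,I_n)$ of elements of $\Omega$ with $I_1=I$, $I_n=I'$ and $|I_k\,\triangle\, I_{k+1}|=1$ for $k=1,\dots,n-1$ (consecutive independent sets differ by adding or removing a single vertex). The communication height between $I,I'\in\Omega$ is $$\phi(I,I'):=\min_{\omega:I\to I'}\ \max_{J\in\omega}\Delta(J).$$ *)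

theory Defs
  imports Complex_Main "HOL-Number_Theory.Cong"
begin

type_synonym vertex = "nat \<times> nat"

definition torus_vertices :: "nat \<Rightarrow> vertex set" where
  "torus_vertices L = {1..L} \<times> {1..L}"

definition cyclic_adjacent :: "nat \<Rightarrow> nat \<Rightarrow> nat \<Rightarrow> bool" where
  "cyclic_adjacent L a b \<longleftrightarrow> [a = b + 1] (mod L) \<or> [b = a + 1] (mod L)"

definition torus_adjacent :: "nat \<Rightarrow> vertex \<Rightarrow> vertex \<Rightarrow> bool" where
  "torus_adjacent L u v \<longleftrightarrow>
     u \<in> torus_vertices L \<and> v \<in> torus_vertices L \<and>
     (fst u = fst v \<and> cyclic_adjacent L (snd u) (snd v) \<or>
      snd u = snd v \<and> cyclic_adjacent L (fst u) (fst v))"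

definition independent_sets :: "nat \<Rightarrow> vertex set set" where
  "independent_sets L =
     {I. I \<subseteq> torus_vertices L \<and> (\<forall>u\<in>I. \<forall>v\<in>I. \<not> torus_adjacent L u v)}"

definition even_vertices :: "nat \<Rightarrow> vertex set" where
  "even_vertices L = {v \<in> torus_vertices L. even (fst v + snd v)}"

definition odd_vertices :: "nat \<Rightarrow> vertex set" where
  "odd_vertices L = {v \<in> torus_vertices L. odd (fst v + snd v)}"

definition efficiency_gap :: "nat \<Rightarrow> vertex set \<Rightarrow> real" where
  "efficiency_gap L I = real L ^ 2 / 2 - real (card I)"

definition is_path :: "nat \<Rightarrow> vertex set \<Rightarrow> vertex set \<Rightarrow> vertex set list \<Rightarrow> bool" where
  "is_path L I I' \<omega> \<longleftrightarrow>
     \<omega> \<noteq> [] \<and> set \<omega> \<subseteq> independent_sets L \<and> hd \<omega> = I \<and> last \<omega> = I' \<and>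
     (\<forall>k. k + 1 < length \<omega> \<longrightarrow> card (sym_diff (\<omega> ! k) (\<omega> ! (k + 1))) = 1)"

text \<open>There are infinitely many paths, but only finitely many path heights, since every height
  is the gap of one of the finitely many independent sets. Any two
  independent sets are joined by a path through the empty set, so the outer minimum exists.\<close>

definition communication_height :: "nat \<Rightarrow> vertex set \<Rightarrow> vertex set \<Rightarrow> real" where
  "communication_height L I I' =
     Min {Max (efficiency_gap L ` set \<omega>) | \<omega>. is_path L I I' \<omega>}"

lemma finite_path_heights:
  "finite {Max (efficiency_gap L ` set \<omega>) | \<omega>. is_path L I I' \<omega>}"
proof (rule finite_subset)
  show "{Max (efficiency_gap L ` set \<omega>) | \<omega>. is_path L I I' \<omega>}
      \<subseteq> efficiency_gap L ` independent_sets L"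
  proof clarify
    fix \<omega> assume p: "is_path L I I' \<omega>"
    then have "Max (efficiency_gap L ` set \<omega>) \<in> efficiency_gap L ` set \<omega>"
      by (intro Max_in) (auto simp: is_path_def)
    moreover have "set \<omega> \<subseteq> independent_sets L"
      using p by (simp add: is_path_def)
    ultimately show "Max (efficiency_gap L ` set \<omega>) \<in> efficiency_gap L ` independent_sets L"
      by blast
  qed
  have "independent_sets L \<subseteq> Pow (torus_vertices L)"
    by (auto simp: independent_sets_def)
  then show "finite (efficiency_gap L ` independent_sets L)"
    by (intro finite_imageI) (auto intro: finite_subset simp: torus_vertices_def)
qed

lemma cyclic_adjacent_parity:
  assumes "even L" "cyclic_adjacent L a b"
  shows "even a \<longleftrightarrow> odd b"
proof -
  have "[a = b + 1] (mod 2) \<or> [b = a + 1] (mod 2)"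
    using assms(2) cong_dvd_modulus_nat[OF _ assms(1)] unfolding cyclic_adjacent_def by blast
  then have "a mod 2 = (b + 1) mod 2 \<or> b mod 2 = (a + 1) mod 2"
    by (simp add: cong_def)
  then show ?thesis by presburger
qed

lemma torus_adjacent_parity:
  assumes "even L" "torus_adjacent L u v"
  shows "even (fst u + snd u) \<longleftrightarrow> odd (fst v + snd v)"
  using assms(2) cyclic_adjacent_parity[OF assms(1), of "fst u" "fst v"]
    cyclic_adjacent_parity[OF assms(1), of "snd u" "snd v"]
  unfolding torus_adjacent_def by auto

lemma even_vertices_independent: "even L \<Longrightarrow> even_vertices L \<in> independent_sets L"
  using torus_adjacent_parity[of L] unfolding independent_sets_def even_vertices_def by blast

lemma odd_vertices_independent: "even L \<Longrightarrow> odd_vertices L \<in> independent_sets L"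
  using torus_adjacent_parity[of L] unfolding independent_sets_def odd_vertices_def by blast

end

theory Submission
  imports Defs
begin

text \<open>
  Lower bound. Consider the first set \<open>C\<close> on a path that contains all odd vertices of some line, say
  a column. Its predecessor \<open>B\<close> has no row with \<open>L / 2\<close> vertices: such a row consists of all its even or
  of all its odd vertices, the latter being excluded by the choice of \<open>C\<close>, and the former because a
  full even row and a full odd column cannot coexist. So every row of \<open>B\<close> has a deficit, and
  \<open>\<Delta>(B) \<ge> L\<close>. If the path never exceeded \<open>L\<close>, the set before \<open>B\<close> would be \<open>B\<close> with one more vertex and
  hence contain a full even row, which is still incompatible with the full odd column two steps later.

  Upper bound. Starting from the even vertices, add the odd ones in lexicographic order, removing the
  even neighbours of each just before. When the set \<open>S\<close> of odd vertices has been added, the gap is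
  \<open>|N(S)| - |S|\<close>, which is at most \<open>L\<close> since \<open>N(S)\<close> is covered by two lines and a translate of \<open>S\<close>;
  during the removals it is at most one larger.
\<close>

section \<open>Parity and independent sets on a cycle\<close>

lemma cyclic_parity:
  assumes "even L" "cyclic_adjacent L a b"
  shows "even a \<longleftrightarrow> odd b"
proof -
  have "even x \<longleftrightarrow> odd y" if "[x = y + 1] (mod L)" for x y
    using cong_dvd_iff[OF cong_dvd_modulus_nat[OF that assms(1)]] by simp
  then show ?thesis
    using assms(2) unfolding cyclic_adjacent_def by blast
qed

lemma torus_parity:
  assumes "even L" "torus_adjacent L u v"
  shows "even (fst u + snd u) \<longleftrightarrow> odd (fst v + snd v)"
  using assms(2) cyclic_parity[OF assms(1), of "fst u" "fst v"]
    cyclic_parity[OF assms(1), of "snd u" "snd v"]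
  unfolding torus_adjacent_def by auto

lemma even_independent: "even L \<Longrightarrow> even_vertices L \<in> independent_sets L"
  using torus_parity[of L] unfolding independent_sets_def even_vertices_def by blast

lemma odd_independent: "even L \<Longrightarrow> odd_vertices L \<in> independent_sets L"
  using torus_parity[of L] unfolding independent_sets_def odd_vertices_def by blast

text \<open>The residue 0 is represented by \<open>L\<close>, so the congruence differs from plain
  arithmetic only where \<open>x\<close> or \<open>y + 1\<close> reaches or passes
  \<open>L\<close>.\<close>

lemma cyclic_adjacent_iff:
  assumes "L \<ge> 4" "a \<in> {1..L}" "b \<in> {1..L}"
  shows "cyclic_adjacent L a b \<longleftrightarrow> a = b + 1 \<or> b = a + 1 \<or> (a = 1 \<and> b = L) \<or> (a = L \<and> b = 1)"
proof -
  have *: "[x = y + 1] (mod L) \<longleftrightarrow> x = y + 1 \<or> (x = 1 \<and> y = L)"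
    if "x \<in> {1..L}" "y \<in> {1..L}" for x y
  proof (cases "y = L")
    case True
    have "[x = L + 1] (mod L) \<longleftrightarrow> [x = 1] (mod L)"
      unfolding cong_def by (metis mod_add_self1)
    also have "\<dots> \<longleftrightarrow> x = 1"
      using that assms(1) by (cases "x = L") (auto simp: cong_def)
    finally show ?thesis
      using that True by auto
  next
    case False
    show ?thesis
    proof (cases "x = L \<or> y + 1 = L")
      case True
      then show ?thesis
        using that False assms(1) dvd_imp_le[of L "Suc y"] dvd_imp_le[of L x]
        by (auto simp: cong_def)
    next
      case F: False
      then have "x < L" "y + 1 < L"
        using that False by auto
      then show ?thesis
        using that False by (auto simp: cong_def)
    qed
  qed
  show ?thesis
    unfolding cyclic_adjacent_def using *[OF assms(2,3)] *[OF assms(3,2)] by blast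
qed

lemma cyclic_adjacent_sym: "cyclic_adjacent L a b \<longleftrightarrow> cyclic_adjacent L b a"
  unfolding cyclic_adjacent_def by blast

lemma torus_adjacent_sym: "torus_adjacent L u v \<longleftrightarrow> torus_adjacent L v u"
  unfolding torus_adjacent_def using cyclic_adjacent_sym by metis

text \<open>That \<open>a\<close> and \<open>b\<close> differ is the point: a single changed vertex
  cannot account for both. On a cycle of length 2 they would coincide.\<close>

lemma two_cyclic_neighbours:
  assumes "L \<ge> 4" "c \<in> {1..L}"
  obtains a b where "a \<in> {1..L}" "b \<in> {1..L}" "a \<noteq> b"
    "cyclic_adjacent L c a" "cyclic_adjacent L c b"
proof
  let ?a = "if c = L then 1 else c + 1" and ?b = "if c = 1 then L else c - 1"
  show ab: "?a \<in> {1..L}" "?b \<in> {1..L}" and "?a \<noteq> ?b"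
    using assms by auto
  show "cyclic_adjacent L c ?a" "cyclic_adjacent L c ?b"
    unfolding cyclic_adjacent_iff[OF assms ab(1)] cyclic_adjacent_iff[OF assms ab(2)]
    using assms by auto
qed

text \<open>The successor map \<open>s\<close> of the cycle is injective and moves \<open>S\<close>
  off itself, which gives the bound. In the case of equality \<open>S\<close> and its image
  partition the cycle, so membership alternates and \<open>S\<close> is one of the two parity
  classes.\<close>

lemma cyclic_independent_card:
  assumes L: "L \<ge> 4" and S: "S \<subseteq> {1..L}"
    and ind: "\<And>a b. a \<in> S \<Longrightarrow> b \<in> S \<Longrightarrow> \<not> cyclic_adjacent L a b"
  shows "2 * card S \<le> L"
    and "2 * card S = L \<Longrightarrow> c \<in> {1..L} \<Longrightarrow> c \<in> S \<longleftrightarrow> (1 \<in> S \<longleftrightarrow> odd c)"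
proof -
  define s where "s c = (if c = L then 1 else c + 1)" for c
  have inj: "inj_on s S"
    using S by (auto simp: s_def inj_on_def split: if_splits)
  have sub: "s ` S \<subseteq> {1..L}"
    using S L by (auto simp: s_def)
  have adj: "cyclic_adjacent L c (s c)" if "c \<in> {1..L}" for c
    using that L by (subst cyclic_adjacent_iff) (auto simp: s_def)
  have disj: "S \<inter> s ` S = {}"
    using adj S ind by blast
  have fin: "finite S"
    using S finite_subset by blast
  have card: "card (S \<union> s ` S) = 2 * card S"
    using card_Un_disjoint[OF fin _ disj] fin card_image[OF inj] by simp
  then show "2 * card S \<le> L"
    using card_mono[of "{1..L}" "S \<union> s ` S"] S sub by simp
  show "c \<in> S \<longleftrightarrow> (1 \<in> S \<longleftrightarrow> odd c)" if full: "2 * card S = L" and "c \<in> {1..L}"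
  proof -
    have cover: "S \<union> s ` S = {1..L}"
      by (rule card_subset_eq) (use S sub card full in auto)
    have step: "c + 1 \<in> S \<longleftrightarrow> c \<notin> S" if "1 \<le> c" "c < L" for c
    proof
      show "c \<notin> S" if "c + 1 \<in> S"
        using ind[OF _ that] \<open>1 \<le> c\<close> \<open>c < L\<close> adj[of c] by (auto simp: s_def)
      show "c + 1 \<in> S" if "c \<notin> S"
      proof (rule ccontr)
        assume "c + 1 \<notin> S"
        then have "c + 1 \<in> s ` S"
          using cover \<open>1 \<le> c\<close> \<open>c < L\<close> by auto
        then show False
          using that \<open>1 \<le> c\<close> by (auto simp: s_def split: if_splits)
      qed
    qed
    have "1 \<le> c" "c \<le> L"
      using that by auto
    then show ?thesis
    proof (induction c rule: dec_induct)
      case base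
      then show ?case by simp
    next
      case (step m)
      then show ?case
        using \<open>\<And>c. 1 \<le> c \<Longrightarrow> c < L \<Longrightarrow> c + 1 \<in> S \<longleftrightarrow> c \<notin> S\<close>[of m] by auto
    qed
  qed
qed

section \<open>Full rows and full columns\<close>

definition odd_row :: "nat \<Rightarrow> vertex set \<Rightarrow> nat \<Rightarrow> bool" where
  "odd_row L I r \<longleftrightarrow> r \<in> {1..L} \<and> (\<forall>c\<in>{1..L}. odd (r + c) \<longrightarrow> (r, c) \<in> I)"

definition even_row :: "nat \<Rightarrow> vertex set \<Rightarrow> nat \<Rightarrow> bool" where
  "even_row L I r \<longleftrightarrow> r \<in> {1..L} \<and> (\<forall>c\<in>{1..L}. even (r + c) \<longrightarrow> (r, c) \<in> I)"

text \<open>All three notions ask only for containment, so they are monotone in \<open>I\<close>: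
  adding vertices cannot destroy a full line.\<close>

definition odd_column :: "nat \<Rightarrow> vertex set \<Rightarrow> nat \<Rightarrow> bool" where
  "odd_column L I c \<longleftrightarrow> c \<in> {1..L} \<and> (\<forall>r\<in>{1..L}. odd (r + c) \<longrightarrow> (r, c) \<in> I)"

lemma independent_finite: "I \<in> independent_sets L \<Longrightarrow> finite I"
  unfolding independent_sets_def torus_vertices_def using finite_subset by blast

lemma card_by_rows:
  assumes "I \<subseteq> torus_vertices L"
  shows "card I = (\<Sum>r=1..L. card {c. (r, c) \<in> I})"
proof -
  have "card I = card (Sigma {1..L} (\<lambda>r. {c. (r, c) \<in> I}))"
    using assms by (intro arg_cong[of _ _ card]) (auto simp: torus_vertices_def)
  moreover have "finite {c. (r, c) \<in> I}" for r
    by (rule finite_subset[of _ "{1..L}"]) (use assms in \<open>auto simp: torus_vertices_def\<close>)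
  ultimately show ?thesis
    by simp
qed

lemma full_row:
  assumes "L \<ge> 4" "I \<in> independent_sets L" "r \<in> {1..L}" "L \<le> 2 * card {c. (r, c) \<in> I}"
  shows "odd_row L I r \<or> even_row L I r"
proof -
  let ?S = "{c. (r, c) \<in> I}"
  have S: "?S \<subseteq> {1..L}"
    using assms(2) by (auto simp: independent_sets_def torus_vertices_def)
  have ind: "\<not> cyclic_adjacent L a b" if "a \<in> ?S" "b \<in> ?S" for a b
  proof -
    have "(r, a) \<in> torus_vertices L" "(r, b) \<in> torus_vertices L"
      "\<not> torus_adjacent L (r, a) (r, b)"
      using assms(2) that by (auto simp: independent_sets_def)
    then show ?thesis
      by (simp add: torus_adjacent_def)
  qed
  have "2 * card ?S = L"
    using cyclic_independent_card(1)[OF assms(1) S ind] assms(4) by simp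
  from cyclic_independent_card(2)[OF assms(1) S ind this]
  have mem: "(r, c) \<in> I \<longleftrightarrow> (1 \<in> ?S \<longleftrightarrow> odd c)" if "c \<in> {1..L}" for c
    using that by blast
  show ?thesis
  \<comment> \<open>The vertex \<open>(r, 1)\<close> is odd iff \<open>r\<close> is even, so this
    asks whether the parity class filling the row is the odd one.\<close>
  proof (cases "1 \<in> ?S \<longleftrightarrow> even r")
    case True
    then have "(r, c) \<in> I" if "c \<in> {1..L}" "odd (r + c)" for c
      using that(2) mem[OF that(1)] unfolding even_add by blast
    then show ?thesis
      using assms(3) by (auto simp only: odd_row_def)
  next
    case False
    then have "(r, c) \<in> I" if "c \<in> {1..L}" "even (r + c)" for c
      using that(2) mem[OF that(1)] unfolding even_add by blast
    then show ?thesis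
      using assms(3) by (auto simp only: even_row_def)
  qed
qed

text \<open>By \<open>full_row\<close> each row falls short of \<open>L div 2\<close> by at least
  one vertex, and the \<open>L\<close> deficits add up to a gap of at least
  \<open>L\<close>.\<close>

lemma rows_not_full_card:
  assumes "L \<ge> 4" "even L" "I \<in> independent_sets L"
    and "\<And>r. \<not> odd_row L I r" "\<And>r. \<not> even_row L I r"
  shows "card I + L \<le> L * (L div 2)"
proof -
  have I: "I \<subseteq> torus_vertices L"
    using assms(3) by (simp add: independent_sets_def)
  have "card {c. (r, c) \<in> I} + 1 \<le> L div 2" if "r \<in> {1..L}" for r
    using full_row[OF assms(1,3) that] assms(2,4,5) by fastforce
  then have "(\<Sum>r=1..L. card {c. (r, c) \<in> I} + 1) \<le> (\<Sum>r=1..L. L div 2)"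
    by (intro sum_mono) auto
  then show ?thesis
    using card_by_rows[OF I] by (simp only: sum.distrib) simp
qed

text \<open>The slack \<open>u\<close>, \<open>v\<close> is harmless because every vertex of a line has two neighbours on it.\<close>

lemma even_row_odd_column_exclusive:
  assumes L: "L \<ge> 4" "even L" and A: "A \<in> independent_sets L" and C: "C \<in> independent_sets L"
    and "even_row L A r" "odd_column L C c"
    and AC: "A \<subseteq> insert u C" "C \<subseteq> insert v A"
  shows False
proof -
  have r: "r \<in> {1..L}" and c: "c \<in> {1..L}"
    and row: "\<And>c'. c' \<in> {1..L} \<Longrightarrow> even (r + c') \<Longrightarrow> (r, c') \<in> A"
    and col: "\<And>r'. r' \<in> {1..L} \<Longrightarrow> odd (r' + c) \<Longrightarrow> (r', c) \<in> C"
    using assms(5,6) by (auto simp: even_row_def odd_column_def)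
  show False
  \<comment> \<open>The lines cross at \<open>(r, c)\<close>. If this vertex is odd, it lies in
    \<open>C\<close>, so both its row neighbours lie in \<open>A\<close> but not in
    \<open>C\<close>; \<open>u\<close> can only be one of them. If it is even, it lies in
    \<open>A\<close>, and its two column neighbours contradict the slack \<open>v\<close> in the
    same way.\<close>
  proof (cases "odd (r + c)")
    case True
    obtain a b where ab: "a \<in> {1..L}" "b \<in> {1..L}" "a \<noteq> b"
      "cyclic_adjacent L c a" "cyclic_adjacent L c b"
      using two_cyclic_neighbours[OF L(1) c] by blast
    have "(r, a) \<in> A" "(r, b) \<in> A"
      using row ab(1,2) True cyclic_parity[OF L(2) ab(4)]
        cyclic_parity[OF L(2) ab(5)] by auto
    moreover have "torus_adjacent L (r, c) (r, a)" "torus_adjacent L (r, c) (r, b)"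
      using ab r c by (auto simp: torus_adjacent_def torus_vertices_def)
    then have "(r, a) \<notin> C" "(r, b) \<notin> C"
      using C col[OF r True] by (auto simp: independent_sets_def)
    ultimately show False
      using AC(1) ab(3) by auto
  next
    case False
    obtain a b where ab: "a \<in> {1..L}" "b \<in> {1..L}" "a \<noteq> b"
      "cyclic_adjacent L r a" "cyclic_adjacent L r b"
      using two_cyclic_neighbours[OF L(1) r] by blast
    have "(a, c) \<in> C" "(b, c) \<in> C"
      using col ab(1,2) False cyclic_parity[OF L(2) ab(4)]
        cyclic_parity[OF L(2) ab(5)] by auto
    moreover have "torus_adjacent L (r, c) (a, c)" "torus_adjacent L (r, c) (b, c)"
      using ab r c by (auto simp: torus_adjacent_def torus_vertices_def)
    then have "(a, c) \<notin> A" "(b, c) \<notin> A"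
      using A row[OF c] False by (auto simp: independent_sets_def)
    ultimately show False
      using AC(2) ab(3) by auto
  qed
qed

lemma sym_diff_card_1_cases:
  assumes "card (sym_diff A B) = 1"
  obtains x where "x \<notin> A" "B = insert x A" | x where "x \<notin> B" "A = insert x B"
proof -
  obtain x where x: "sym_diff A B = {x}"
    using assms by (rule card_1_singletonE)
  have other: "y \<in> A \<longleftrightarrow> y \<in> B" if "y \<noteq> x" for y
    using x that by blast
  have "x \<in> A \<longleftrightarrow> x \<notin> B"
    using x by blast
  then consider "x \<notin> A" "x \<in> B" | "x \<in> A" "x \<notin> B"
    by blast
  then show thesis
  proof cases
    case 1
    then have "B = insert x A"
      using other by (intro set_eqI) (metis insert_iff)
    then show ?thesis
      using 1 that(1) by blast
  next
    case 2
    then have "A = insert x B"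
      using other by (intro set_eqI) (metis insert_iff)
    then show ?thesis
      using 2 that(2) by blast
  qed
qed

text \<open>A removal cannot complete a column, so the step from \<open>B\<close> to
  \<open>C\<close> adds a vertex. A full even row of \<open>B\<close> would then survive in
  \<open>C\<close> and cross the odd column there; hence no row of \<open>B\<close> is full.\<close>

lemma first_odd_column_card:
  assumes L: "L \<ge> 4" "even L" and B: "B \<in> independent_sets L" and C: "C \<in> independent_sets L"
    and step: "card (sym_diff B C) = 1"
    and no: "\<And>r. \<not> odd_row L B r" "\<And>c. \<not> odd_column L B c" and col: "odd_column L C c"
  shows "\<exists>v. C = insert v B" and "card B + L \<le> L * (L div 2)"
proof -
  show ex: "\<exists>v. C = insert v B"
    using step
  proof (cases rule: sym_diff_card_1_cases)
    case (2 x)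
    then have "odd_column L B c"
      using col by (auto simp: odd_column_def)
    then show ?thesis using no by blast
  qed auto
  then have BC: "B \<subseteq> C" by auto
  have "\<not> even_row L B r" for r
  proof
    assume "even_row L B r"
    then have "even_row L C r"
      using BC by (auto simp: even_row_def)
    then show False
      using even_row_odd_column_exclusive[OF L C C _ col] by blast
  qed
  then show "card B + L \<le> L * (L div 2)"
    using rows_not_full_card[OF L B no(1)] by blast
qed

text \<open>The bounds force the gap of \<open>B\<close> to be exactly \<open>L\<close>, so that of
  \<open>A\<close> is \<open>L - 1\<close> and \<open>A\<close> is \<open>B\<close> plus a vertex
  \<open>u\<close>. With so small a gap \<open>A\<close> has a full row, necessarily even. Since
  \<open>A\<close> and \<open>C\<close> each exceed \<open>B\<close> by one vertex, the exclusion
  lemma applies with slack \<open>u\<close>, \<open>v\<close>.\<close>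

lemma first_odd_column_impossible:
  assumes L: "L \<ge> 4" "even L" and A: "A \<in> independent_sets L"
    and B: "B \<in> independent_sets L" and C: "C \<in> independent_sets L"
    and step: "card (sym_diff A B) = 1" "card (sym_diff B C) = 1"
    and noA: "\<And>r. \<not> odd_row L A r"
    and noB: "\<And>r. \<not> odd_row L B r" "\<And>c. \<not> odd_column L B c" and col: "odd_column L C c"
    and gap: "L * (L div 2) \<le> card A + L" "L * (L div 2) \<le> card B + L"
  shows False
proof -
  note BC = first_odd_column_card[OF L B C step(2) noB col]
  obtain v where v: "C = insert v B"
    using BC(1) by blast
  have eq: "card B + L = L * (L div 2)"
    using BC(2) gap(2) by simp
  have "\<exists>u. u \<notin> B \<and> A = insert u B"
    using step(1)
  proof (cases rule: sym_diff_card_1_cases)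
    case (1 x)
    then have "card B = card A + 1"
      using independent_finite[OF A] by simp
    then show ?thesis
      using gap(1) eq by simp
  qed blast
  then obtain u where u: "u \<notin> B" "A = insert u B"
    by blast
  have "card A = card B + 1"
    using u independent_finite[OF B] by simp
  then have "\<not> card A + L \<le> L * (L div 2)"
    using eq by simp
  then obtain r where "even_row L A r"
    using rows_not_full_card[OF L A noA] by blast
  then show False
    using even_row_odd_column_exclusive[OF L A C _ col, of r u v] u v by auto
qed

section \<open>Transposition, the size of the even class, and the lower bound\<close>

lemma mem_swap_image: "(a, b) \<in> prod.swap ` I \<longleftrightarrow> (b, a) \<in> I"
  by force

lemma swap_independent:
  assumes "I \<in> independent_sets L"
  shows "prod.swap ` I \<in> independent_sets L"
proof -
  have "torus_adjacent L (prod.swap u) (prod.swap v) \<longleftrightarrow> torus_adjacent L u v" for u v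
    by (cases u; cases v) (auto simp: torus_adjacent_def torus_vertices_def)
  then show ?thesis
    using assms by (auto simp: independent_sets_def torus_vertices_def)
qed

text \<open>Reduces the case in which an odd row is completed first to that of an odd
  column.\<close>

lemma swap_odd_lines:
  "odd_row L (prod.swap ` I) k \<longleftrightarrow> odd_column L I k"
  "odd_column L (prod.swap ` I) k \<longleftrightarrow> odd_row L I k"
  unfolding odd_row_def odd_column_def mem_swap_image by (auto simp: add.commute)

lemma card_swap_image: "card (prod.swap ` I) = card I"
  by (intro card_image) simp

lemma card_sym_diff_swap_image:
  "card (sym_diff (prod.swap ` A) (prod.swap ` B)) = card (sym_diff A B)"
  by (simp flip: image_set_diff image_Un add: card_swap_image)

text \<open>The involution \<open>f\<close> exchanges columns 2k-1 and 2k, which stays inside the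
  grid because \<open>L\<close> is even. It swaps the two parity classes, so each is half of the
  grid.\<close>

lemma card_even_vertices:
  assumes "even L"
  shows "card (even_vertices L) = L * (L div 2)"
proof -
  define f where "f = (\<lambda>(r::nat, c::nat). (r, if odd c then c + 1 else c - 1))"
  have "bij_betw f (even_vertices L) (odd_vertices L)"
  proof (rule bij_betw_byWitness[of _ f])
    have "c + 1 \<le> L" if "odd c" "c \<le> L" for c
      using that assms by (cases "c = L") auto
    moreover have "1 \<le> c - 1" if "even c" "1 \<le> c" for c :: nat
      using that by (cases "c = 1") auto
    ultimately show "f ` even_vertices L \<subseteq> odd_vertices L" "f ` odd_vertices L \<subseteq> even_vertices L"
      unfolding f_def even_vertices_def odd_vertices_def torus_vertices_def by fastforce+
    have "f (f v) = v" if "v \<in> torus_vertices L" for v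
      using that by (cases v) (auto simp: f_def torus_vertices_def)
    then show "\<forall>v\<in>even_vertices L. f (f v) = v" "\<forall>v\<in>odd_vertices L. f (f v) = v"
      by (auto simp: even_vertices_def odd_vertices_def)
  qed
  then have eq: "card (odd_vertices L) = card (even_vertices L)"
    using bij_betw_same_card by metis
  have fin: "finite (torus_vertices L)"
    by (simp add: torus_vertices_def)
  have "card (even_vertices L) + card (odd_vertices L) = card (even_vertices L \<union> odd_vertices L)"
    by (intro card_Un_disjoint[symmetric])
       (auto intro: finite_subset[OF _ fin] simp: even_vertices_def odd_vertices_def)
  also have "even_vertices L \<union> odd_vertices L = torus_vertices L"
    by (auto simp: even_vertices_def odd_vertices_def)
  also have "card \<dots> = L * L"
    by (simp add: torus_vertices_def)
  finally have "2 * card (even_vertices L) = L * L"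
    using eq by simp
  also have "\<dots> = 2 * (L * (L div 2))"
    using dvd_mult_div_cancel[OF assms] by (simp only: mult.left_commute)
  finally show ?thesis
    by simp
qed

lemma path_height_lower_bound:
  assumes L: "L \<ge> 4" "even L" and path: "is_path L (even_vertices L) (odd_vertices L) \<omega>"
  shows "\<exists>J\<in>set \<omega>. card J + L < L * (L div 2)"
proof (rule ccontr)
  assume "\<not> ?thesis"
  then have gap: "L * (L div 2) \<le> card (\<omega> ! i) + L" if "i < length \<omega>" for i
    using that by (meson nth_mem not_less)
  have ind: "\<omega> ! i \<in> independent_sets L" if "i < length \<omega>" for i
    using path that by (auto simp: is_path_def)
  have first: "\<omega> ! 0 = even_vertices L" and last: "\<omega> ! (length \<omega> - 1) = odd_vertices L"
    using path by (auto simp: is_path_def hd_conv_nth last_conv_nth)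
  have step: "card (sym_diff (\<omega> ! i) (\<omega> ! (Suc i))) = 1" if "Suc i < length \<omega>" for i
    using path that by (auto simp: is_path_def)
  define Q where "Q i \<longleftrightarrow> (\<exists>r. odd_row L (\<omega> ! i) r) \<or> (\<exists>c. odd_column L (\<omega> ! i) c)" for i
  have len: "0 < length \<omega>"
    using path by (auto simp: is_path_def)
  have "odd_row L (odd_vertices L) 1"
    using L by (auto simp: odd_row_def odd_vertices_def torus_vertices_def)
  then have "Q (length \<omega> - 1)"
    unfolding Q_def last by blast
  \<comment> \<open>The first index at which some odd line, row or column, is full.\<close>
  define k where "k = (LEAST i. Q i)"
  have "Q k"
    unfolding k_def using \<open>Q (length \<omega> - 1)\<close> by (rule LeastI)
  have before: "\<not> Q i" if "i < k" for i
    using that not_less_Least unfolding k_def by blast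
  have "k \<le> length \<omega> - 1"
    unfolding k_def using \<open>Q (length \<omega> - 1)\<close> by (rule Least_le)
  then have k: "k < length \<omega>"
    using len by linarith
  have no_line: "\<not> odd_row L (even_vertices L) r" "\<not> odd_column L (even_vertices L) r" for r
  proof -
    \<comment> \<open>Every line contains an odd vertex, so fullness does not hold vacuously for the
      even set.\<close>
    have "\<exists>c\<in>{1..L}. odd (r + c)"
      by (rule bexI[of _ "if odd r then 2 else 1"]) (use L in auto)
    then show "\<not> odd_row L (even_vertices L) r" "\<not> odd_column L (even_vertices L) r"
      by (auto simp: odd_row_def odd_column_def even_vertices_def add.commute)
  qed
  then have "\<not> Q 0"
    by (simp add: Q_def first)
  then obtain j where j: "k = Suc j"
    using \<open>Q k\<close> by (cases k) auto
  let ?B = "\<omega> ! j" and ?C = "\<omega> ! Suc j"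
  have noB: "\<not> odd_row L ?B r" "\<not> odd_column L ?B r" for r
    using before[of j] j by (auto simp: Q_def)
  have BC: "?B \<in> independent_sets L" "?C \<in> independent_sets L" "card (sym_diff ?B ?C) = 1"
    using ind step k j by auto
  note BC' = BC(1,2)[THEN swap_independent] card_sym_diff_swap_image[THEN trans, OF BC(3)]
  have noB': "\<not> odd_row L (prod.swap ` ?B) r" "\<not> odd_column L (prod.swap ` ?B) r" for r
    using noB by (simp_all add: swap_odd_lines)
  \<comment> \<open>A full odd row of \<open>?C\<close> is read as a full odd column of its
    transpose; both cases then use the column lemmas.\<close>
  obtain c where c: "odd_column L ?C c \<or> odd_column L (prod.swap ` ?C) c"
    using \<open>Q k\<close> by (auto simp: Q_def j swap_odd_lines)
  have card_B: "card ?B + L \<le> L * (L div 2)"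
    using c
  proof
    assume "odd_column L ?C c"
    then show ?thesis
      by (rule first_odd_column_card(2)[OF L BC noB])
  next
    assume "odd_column L (prod.swap ` ?C) c"
    from first_odd_column_card(2)[OF L BC' noB' this] show ?thesis
      by (simp only: card_swap_image)
  qed
  \<comment> \<open>The gap of \<open>?B\<close> is at least \<open>L\<close>, whereas the initial
    set has gap 0, so \<open>?B\<close> has a predecessor.\<close>
  have "j \<noteq> 0"
  proof
    assume "j = 0"
    then have "L * (L div 2) + L \<le> L * (L div 2)"
      using card_B first card_even_vertices[OF L(2)] by simp
    then show False
      using L(1) by simp
  qed
  then obtain i where i: "j = Suc i"
    by (cases j) auto
  let ?A = "\<omega> ! i"
  have noA: "\<not> odd_row L ?A r" "\<not> odd_column L ?A r" for r
    using before[of i] i j by (auto simp: Q_def)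
  have AB: "?A \<in> independent_sets L" "card (sym_diff ?A ?B) = 1"
    using ind step k j i by auto
  have low: "L * (L div 2) \<le> card ?A + L" "L * (L div 2) \<le> card ?B + L"
    using gap k j i by auto
  show False
    using c
  proof
    assume "odd_column L ?C c"
    then show False
      using first_odd_column_impossible[OF L AB(1) BC(1,2) AB(2) BC(3) noA(1) noB _ low] by blast
  next
    assume col: "odd_column L (prod.swap ` ?C) c"
    have "\<not> odd_row L (prod.swap ` ?A) r" for r
      using noA by (simp add: swap_odd_lines)
    from first_odd_column_impossible[OF L AB(1)[THEN swap_independent] BC'(1,2)
        card_sym_diff_swap_image[THEN trans, OF AB(2)] BC'(3) this noB' col]
    show False
      using low by (simp add: card_swap_image)
  qed
qed

section \<open>Paths of height at most \<open>L + 1\<close>\<close>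

definition low_step :: "nat \<Rightarrow> vertex set \<Rightarrow> vertex set \<Rightarrow> bool" where
  "low_step L A B \<longleftrightarrow> A \<in> independent_sets L \<and> B \<in> independent_sets L \<and>
     card (sym_diff A B) = 1 \<and> L * (L div 2) \<le> card B + L + 1"

text \<open>Translates reachability, which composes easily, into list paths. A
  \<open>low_step\<close> bounds only the gap of its target, so the bound for the starting set is a
  separate assumption.\<close>

lemma low_steps_path:
  assumes "(low_step L)\<^sup>*\<^sup>* A B" "A \<in> independent_sets L" "L * (L div 2) \<le> card A + L + 1"
  shows "\<exists>\<omega>. is_path L A B \<omega> \<and> (\<forall>J\<in>set \<omega>. L * (L div 2) \<le> card J + L + 1)"
  using assms(1)
proof (induction rule: rtranclp_induct)
  case base
  show ?case
    using assms(2,3) by (intro exI[of _ "[A]"]) (simp add: is_path_def)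
next
  case (step B C)
  then obtain \<omega> where p: "is_path L A B \<omega>" and low: "\<forall>J\<in>set \<omega>. L * (L div 2) \<le> card J + L + 1"
    by blast
  have "card (sym_diff ((\<omega> @ [C]) ! k) ((\<omega> @ [C]) ! (k + 1))) = 1"
    if "k + 1 < length (\<omega> @ [C])" for k
  proof (cases "k + 1 < length \<omega>")
    case True
    then show ?thesis
      using p by (simp add: nth_append is_path_def)
  next
    case False
    then have k: "k = length \<omega> - 1" "k + 1 = length \<omega>"
      using that by auto
    then have "\<omega> ! k = B"
      using p by (auto simp: is_path_def last_conv_nth)
    then show ?thesis
      using step(2) k(2) by (simp add: nth_append low_step_def)
  qed
  then have "is_path L A C (\<omega> @ [C])"
    using p step(2) by (auto simp: is_path_def low_step_def)
  then show ?case
    using low step(2) by (intro exI[of _ "\<omega> @ [C]"]) (auto simp: low_step_def)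
qed

lemma independent_subset: "A \<in> independent_sets L \<Longrightarrow> B \<subseteq> A \<Longrightarrow> B \<in> independent_sets L"
  unfolding independent_sets_def by blast

text \<open>The gap only grows during removals, so bounding it at the end bounds it
  throughout.\<close>

lemma low_steps_remove:
  assumes "finite D" "D \<subseteq> A" "A \<in> independent_sets L" "L * (L div 2) \<le> card (A - D) + L + 1"
  shows "(low_step L)\<^sup>*\<^sup>* A (A - D)"
  using assms(1,2,4)
proof (induction D rule: finite_induct)
  case (insert x D)
  have "card (A - insert x D) \<le> card (A - D)"
    using independent_finite[OF assms(3)] by (intro card_mono) auto
  then have "(low_step L)\<^sup>*\<^sup>* A (A - D)"
    using insert by simp
  moreover have "sym_diff (A - D) (A - insert x D) = {x}"
    using insert by auto
  then have "low_step L (A - D) (A - insert x D)"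
    using insert.prems independent_subset[OF assms(3)] by (simp add: low_step_def)
  ultimately show ?case by simp
qed simp

section \<open>Regions of odd vertices and the upper bound\<close>

definition neighbours :: "nat \<Rightarrow> vertex set \<Rightarrow> vertex set" where
  "neighbours L S = {w. \<exists>v\<in>S. torus_adjacent L v w}"

text \<open>For a set \<open>S\<close> of odd vertices this is the largest independent set whose odd
  part is \<open>S\<close>.\<close>

definition odd_region :: "nat \<Rightarrow> vertex set \<Rightarrow> vertex set" where
  "odd_region L S = S \<union> (even_vertices L - neighbours L S)"

text \<open>Only lines with smaller first coordinate must be filled; within the last occupied line
  any selection is allowed. Lexicographic initial segments are instances.\<close>

definition left_closed :: "nat \<Rightarrow> vertex set \<Rightarrow> bool" where
  "left_closed L S \<longleftrightarrow> S \<subseteq> odd_vertices L \<and>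
     (\<forall>v\<in>S. \<forall>w\<in>odd_vertices L. fst w < fst v \<longrightarrow> w \<in> S)"

lemma neighbours_of_odd:
  assumes "even L" "S \<subseteq> odd_vertices L"
  shows "neighbours L S \<subseteq> even_vertices L"
proof
  fix w assume "w \<in> neighbours L S"
  then obtain v where v: "v \<in> S" "torus_adjacent L v w"
    by (auto simp: neighbours_def)
  then have "odd (fst v + snd v)" "w \<in> torus_vertices L"
    using assms(2) by (auto simp: odd_vertices_def torus_adjacent_def)
  then show "w \<in> even_vertices L"
    using torus_parity[OF assms(1) v(2)] by (simp add: even_vertices_def)
qed

lemma odd_region_independent:
  assumes "even L" "S \<subseteq> odd_vertices L"
  shows "odd_region L S \<in> independent_sets L"
proof -
  let ?E = "even_vertices L - neighbours L S"
  have ind: "S \<in> independent_sets L" "?E \<in> independent_sets L"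
    using independent_subset odd_independent[OF assms(1)] assms(2)
      even_independent[OF assms(1)] by blast+
  have "\<not> torus_adjacent L u v" "\<not> torus_adjacent L v u" if "u \<in> S" "v \<in> ?E" for u v
    using that torus_adjacent_sym[of L u v] by (auto simp: neighbours_def)
  then show ?thesis
    using ind unfolding odd_region_def independent_sets_def by (simp add: ball_Un)
qed

text \<open>Apart from the first and the last line, every neighbour of a left-closed set is a translate
  by one of a member of the set.\<close>

lemma card_neighbours_left_closed:
  assumes L: "L \<ge> 4" "even L" and S: "left_closed L S"
  shows "card (neighbours L S) \<le> card S + L"
proof -
  let ?P = "{b \<in> {1..L}. odd b}" and ?Q = "{b \<in> {1..L}. even b}"
  let ?shift = "\<lambda>(a, b). (a + 1, b) :: vertex"
  have odd: "S \<subseteq> odd_vertices L"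
    using S by (simp add: left_closed_def)
  have fin: "finite S"
    using independent_finite independent_subset[OF odd_independent[OF L(2)] odd] by blast
  have cards: "card ?P \<le> L div 2" "card ?Q \<le> L div 2"
  proof -
    \<comment> \<open>A parity class contains no two cyclic neighbours, so the cycle bound counts
      it.\<close>
    have "2 * card ?P \<le> L"
      using cyclic_parity[OF L(2)] by (intro cyclic_independent_card(1)[OF L(1)]) auto
    moreover have "2 * card ?Q \<le> L"
      using cyclic_parity[OF L(2)] by (intro cyclic_independent_card(1)[OF L(1)]) auto
    ultimately show "card ?P \<le> L div 2" "card ?Q \<le> L div 2"
      by simp_all
  qed
  have sub: "neighbours L S \<subseteq> {1} \<times> ?P \<union> {L} \<times> ?Q \<union> ?shift ` S"
  proof
    fix w assume w: "w \<in> neighbours L S"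
    obtain x y where xy: "w = (x, y)" by fastforce
    obtain a b where ab: "(a, b) \<in> S" "torus_adjacent L (a, b) (x, y)"
      using w xy by (auto simp: neighbours_def)
    have "(x, y) \<in> even_vertices L"
      using neighbours_of_odd[OF L(2) odd] w xy by blast
    then have range: "x \<in> {1..L}" "y \<in> {1..L}" "even (x + y)"
      by (auto simp: even_vertices_def torus_vertices_def)
    show "w \<in> {1} \<times> ?P \<union> {L} \<times> ?Q \<union> ?shift ` S"
    proof (cases "x = 1 \<or> x = L")
      case True
      then show ?thesis
        using range xy L(2) by auto
    next
      case False
      then have x: "1 < x" "x < L"
        using range by auto
      have ain: "a \<in> {1..L}"
        using ab(2) by (auto simp: torus_adjacent_def torus_vertices_def)
      have "(x - 1, y) \<in> odd_vertices L"
        using x range by (auto simp: odd_vertices_def torus_vertices_def)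
      then have closed: "(x - 1, y) \<in> S" if "x - 1 < a"
        using S ab(1) that by (auto simp: left_closed_def)
      \<comment> \<open>Away from the boundary lines there is no wrap-around in the first
        coordinate. If \<open>a\<close> is \<open>x\<close> or \<open>x + 1\<close>, closedness
        supplies \<open>(x - 1, y)\<close>; if \<open>a = x - 1\<close>, that vertex is
        \<open>(a, b)\<close> itself.\<close>
      have "a = x \<or> y = b \<and> (a = x + 1 \<or> x = a + 1)"
        using ab(2) x cyclic_adjacent_iff[OF L(1) ain range(1)] by (auto simp: torus_adjacent_def)
      then have "(x - 1, y) \<in> S"
        using closed ab(1) x by auto
      then have "?shift (x - 1, y) \<in> ?shift ` S"
        by (rule imageI)
      then show ?thesis
        using x xy by simp
    qed
  qed
  have "card (neighbours L S) \<le> card ({1} \<times> ?P \<union> {L} \<times> ?Q \<union> ?shift ` S)"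
    using fin by (intro card_mono[OF _ sub]) auto
  also have "\<dots> \<le> card ({1::nat} \<times> ?P) + card ({L} \<times> ?Q) + card (?shift ` S)"
    by (rule order_trans[OF card_Un_le add_right_mono[OF card_Un_le]])
  also have "\<dots> \<le> L div 2 + L div 2 + card S"
    using cards card_image_le[OF fin, of ?shift] by (simp only: card_cartesian_product_singleton)
  finally show ?thesis
    using dvd_mult_div_cancel[OF L(2)] by linarith
qed

text \<open>Induction on the size of \<open>S\<close>: a vertex \<open>v\<close> in the last
  occupied line is dropped, which keeps the set left-closed. From the smaller region, the even
  neighbours \<open>?D\<close> of \<open>v\<close> are removed and then \<open>v\<close> is
  added.\<close>

lemma low_steps_odd_region:
  assumes L: "L \<ge> 4" "even L" and "left_closed L S"
  shows "(low_step L)\<^sup>*\<^sup>* (even_vertices L) (odd_region L S)"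
  using assms(3)
proof (induction "card S" arbitrary: S)
  case 0
  have "finite S"
    using 0(2) independent_finite[OF odd_independent[OF L(2)]] finite_subset
    by (auto simp: left_closed_def)
  then show ?case
    using 0 by (simp add: odd_region_def neighbours_def)
next
  case (Suc n)
  have odd: "S \<subseteq> odd_vertices L"
    using Suc.prems by (simp add: left_closed_def)
  have fin: "finite S" and ne: "S \<noteq> {}"
    using Suc.hyps(2) card.infinite by fastforce+
  have "Max (fst ` S) \<in> fst ` S"
    using fin ne by (intro Max_in) auto
  then obtain v where v: "v \<in> S" "fst v = Max (fst ` S)"
    by auto
  then have max: "fst w \<le> fst v" if "w \<in> S" for w
    using fin that by simp
  let ?S = "S - {v}"
  let ?A = "odd_region L ?S"
  let ?D = "?A \<inter> neighbours L {v}"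
  have "left_closed L ?S"
    unfolding left_closed_def
  proof (intro conjI ballI impI)
    fix u w assume "u \<in> ?S" "w \<in> odd_vertices L" "fst w < fst u"
    then show "w \<in> ?S"
      using Suc.prems max[of u] by (auto simp: left_closed_def)
  qed (use odd in auto)
  moreover have "n = card ?S"
    using Suc.hyps(2) v(1) by simp
  ultimately have reach: "(low_step L)\<^sup>*\<^sup>* (even_vertices L) ?A"
    using Suc.hyps(1) by blast
  have indA: "?A \<in> independent_sets L" and indS: "odd_region L S \<in> independent_sets L"
    using odd by (auto intro!: odd_region_independent[OF L(2)])
  have disj: "odd_vertices L \<inter> even_vertices L = {}"
    by (auto simp: odd_vertices_def even_vertices_def)
  have nS: "neighbours L S \<subseteq> even_vertices L" "neighbours L {v} \<subseteq> even_vertices L"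
    using odd v(1) by (auto intro!: neighbours_of_odd[OF L(2)] del: subsetI)
  have split: "neighbours L S = neighbours L ?S \<union> neighbours L {v}"
    using v(1) by (auto simp: neighbours_def)
  have AD: "?A - ?D = ?S \<union> (even_vertices L - neighbours L S)"
  proof -
    have "?S \<inter> neighbours L {v} = {}"
      using nS(2) odd disj by blast
    then show ?thesis
      unfolding split odd_region_def by blast
  qed
  have finE: "finite (even_vertices L)"
    using independent_finite[OF even_independent[OF L(2)]] .
  have "card (?A - ?D) = card ?S + card (even_vertices L - neighbours L S)"
    unfolding AD using fin finE odd disj by (intro card_Un_disjoint) auto
  also have "card (even_vertices L - neighbours L S) = L * (L div 2) - card (neighbours L S)"
    using card_Diff_subset[OF finite_subset[OF nS(1) finE] nS(1)] card_even_vertices[OF L(2)]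
    by simp
  \<comment> \<open>The worst moment: all of \<open>neighbours L S\<close> is gone but
    \<open>v\<close> is not yet present, so the gap is \<open>|N(S)| - |S| + 1\<close>, at most
    \<open>L + 1\<close>.\<close>
  finally have low: "L * (L div 2) \<le> card (?A - ?D) + L + 1"
    using card_neighbours_left_closed[OF L Suc.prems] Suc.hyps(2) \<open>n = card ?S\<close> by linarith
  have "(low_step L)\<^sup>*\<^sup>* ?A (?A - ?D)"
    using independent_finite[OF indA] by (intro low_steps_remove[OF _ _ indA low]) auto
  moreover have "low_step L (?A - ?D) (odd_region L S)"
  proof -
    have ins: "odd_region L S = insert v (?A - ?D)"
      unfolding AD using v(1) by (auto simp: odd_region_def)
    moreover have "v \<notin> ?A - ?D"
      unfolding AD using v(1) odd disj by blast
    ultimately have "sym_diff (?A - ?D) (odd_region L S) = {v}"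
      by auto
    moreover have "card (?A - ?D) \<le> card (odd_region L S)"
      using ins independent_finite[OF indS] by (intro card_mono) auto
    moreover have "?A - ?D \<in> independent_sets L"
      by (rule independent_subset[OF indA]) simp
    ultimately show ?thesis
      using low indS by (simp add: low_step_def)
  qed
  ultimately show ?case
    using reach by (meson rtranclp.rtrancl_into_rtrancl rtranclp_trans)
qed

text \<open>Every even vertex has an odd neighbour, so the last region is the target of the
  path.\<close>

lemma odd_region_all:
  assumes L: "L \<ge> 4" "even L"
  shows "odd_region L (odd_vertices L) = odd_vertices L"
proof -
  have "v \<in> neighbours L (odd_vertices L)" if v: "v \<in> even_vertices L" for v
  proof -
    have range: "fst v \<in> {1..L}" "snd v \<in> {1..L}" "even (fst v + snd v)"
      using v by (auto simp: even_vertices_def torus_vertices_def)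
    obtain a where a: "a \<in> {1..L}" "cyclic_adjacent L (snd v) a"
      using two_cyclic_neighbours[OF L(1) range(2)] by blast
    then have adj: "torus_adjacent L (fst v, a) v"
      using range cyclic_adjacent_sym[of L]
      by (cases v) (auto simp: torus_adjacent_def torus_vertices_def)
    moreover have "(fst v, a) \<in> odd_vertices L"
      using torus_parity[OF L(2) adj] range a(1)
      by (simp add: odd_vertices_def torus_vertices_def)
    ultimately show ?thesis
      unfolding neighbours_def by blast
  qed
  then show ?thesis
    by (auto simp: odd_region_def)
qed

section \<open>From cardinalities to the communication height\<close>

lemma efficiency_gap_bound_iff:
  assumes "even L"
  shows "efficiency_gap L I \<le> real L + 1 \<longleftrightarrow> L * (L div 2) \<le> card I + L + 1"
    and "real L + 1 \<le> efficiency_gap L I \<longleftrightarrow> card I + L < L * (L div 2)"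
proof -
  \<comment> \<open>Evenness of \<open>L\<close> makes the natural division exact; gaps are then
    integers, so exceeding \<open>L\<close> means at least \<open>L + 1\<close>.\<close>
  have "real L ^ 2 / 2 = real (L * (L div 2))"
    using assms by (simp add: power2_eq_square real_of_nat_div)
  then have "efficiency_gap L I = real (L * (L div 2)) - real (card I)"
    by (simp add: efficiency_gap_def)
  then show "efficiency_gap L I \<le> real L + 1 \<longleftrightarrow> L * (L div 2) \<le> card I + L + 1"
    and "real L + 1 \<le> efficiency_gap L I \<longleftrightarrow> card I + L < L * (L div 2)"
    by linarith+
qed

theorem theorem3p3:
  fixes L :: nat
  assumes "L \<ge> 4" and "even L"
  shows "communication_height L (even_vertices L) (odd_vertices L) = real L + 1"
proof -
  let ?H = "{Max (efficiency_gap L ` set \<omega>) | \<omega>. is_path L (even_vertices L) (odd_vertices L) \<omega>}"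
  have "left_closed L (odd_vertices L)"
    by (simp add: left_closed_def)
  from low_steps_odd_region[OF assms this]
  have "(low_step L)\<^sup>*\<^sup>* (even_vertices L) (odd_vertices L)"
    by (simp add: odd_region_all[OF assms])
  from low_steps_path[OF this even_independent[OF assms(2)]]
  obtain \<omega> where path: "is_path L (even_vertices L) (odd_vertices L) \<omega>"
    and low: "\<forall>J\<in>set \<omega>. L * (L div 2) \<le> card J + L + 1"
    using card_even_vertices[OF assms(2)] by auto
  have "Max (efficiency_gap L ` set \<omega>) \<le> real L + 1"
    using path low efficiency_gap_bound_iff(1)[OF assms(2)] by (auto simp: is_path_def)
  moreover have "Min ?H \<le> Max (efficiency_gap L ` set \<omega>)"
    using path by (intro Min_le finite_path_heights) auto
  moreover have "real L + 1 \<le> Min ?H"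
  proof -
    \<comment> \<open>The minimum is attained, so the lower bound can be applied to an optimal
      path.\<close>
    have "Min ?H \<in> ?H"
      using path by (intro Min_in finite_path_heights) auto
    then obtain \<omega>' where \<omega>': "Min ?H = Max (efficiency_gap L ` set \<omega>')"
        "is_path L (even_vertices L) (odd_vertices L) \<omega>'"
      by auto
    obtain J where J: "J \<in> set \<omega>'" "card J + L < L * (L div 2)"
      using path_height_lower_bound[OF assms \<omega>'(2)] by blast
    have "real L + 1 \<le> efficiency_gap L J"
      using J(2) efficiency_gap_bound_iff(2)[OF assms(2)] by blast
    also have "\<dots> \<le> Min ?H"
      unfolding \<omega>'(1) using J(1) by (intro Max_ge) auto
    finally show ?thesis .
  qed
  ultimately show ?thesis
    unfolding communication_height_def by linarith
qed

end
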